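(* For $n\ge0$ let $f_n$ be the number of fully tagged polydiagonal subspaces of $\mathbb{R}^n$. The exponential generating function of $(f_n)$ is $$F(x)=\sum_{n=0}^\infty f_n\frac{x^n}{n!}=e^{(e^{2x}-2e^x+2x+1)/2}.$$
   Context: A partial involution on a set $X$ is a map $x\mapsto x^*:\tilde X\to\tilde X$ defined on a (possibly empty) subset $\tilde X\subseteq X$ that is its own inverse. A tagged partition of a finite set $C$ is a partition $\mathcal{P}$ of $C$ (into nonempty classes) together with a partial involution $P\mapsto P^*$ on $\mathcal{P}$ that has at most one fixed point. The class of $i$ is denoted by $[i]$. For a tagged partition $\mathcal{P}$ of $\{1,\ldots,n\}$, the polydiagonal subspace is $$\Delta_{\mathcal{P}}=\{x\in\mathbb{R}^n\mid x_i=x_j\text{ if }[i]=[j],\text{ and }x_i=-x_j\text{ if }[i]^*=[j]\},$$ and $\mathcal{P}\mapsto\Delta_{\mathcal{P}}$ is a bijection from tagged partitions of $\{1,\ldots,n\}$ to polydiagonal subspaces of $\mathbb{R}^n$. For $n=0$ the only tagged partition is the empty one (with empty partial involution), which is fully tagged. $\Delta_{\mathcal{P}}$ is fully tagged if the partial involution is defined on all of $\mathcal{P}$. Exponential generating functions are formal power series. *)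

theory Defs
  imports
    "HOL-Library.FuncSet"
    "HOL-Library.Disjoint_Sets"
    "HOL-Computational_Algebra.Formal_Power_Series"
    Complex_Main
begin

(* Partial maps are option-valued: dom s is the subset on which the involution is defined.
   The second conjunct says both that s maps dom s into itself and that s is its own inverse. *)
definition partial_involution :: "'a set \<Rightarrow> ('a \<rightharpoonup> 'a) \<Rightarrow> bool" where
  "partial_involution X s \<longleftrightarrow>
     dom s \<subseteq> X \<and> (\<forall>x y. s x = Some y \<longrightarrow> s y = Some x)"

definition tagged_partition :: "'a set \<Rightarrow> 'a set set \<Rightarrow> ('a set \<rightharpoonup> 'a set) \<Rightarrow> bool" where
  "tagged_partition C P s \<longleftrightarrow>
     partition_on C P \<and> partial_involution P s \<and>
     (\<forall>A B. s A = Some A \<longrightarrow> s B = Some B \<longrightarrow> A = B)"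

definition fully_tagged_partition :: "'a set \<Rightarrow> 'a set set \<Rightarrow> ('a set \<rightharpoonup> 'a set) \<Rightarrow> bool" where
  "fully_tagged_partition C P s \<longleftrightarrow> tagged_partition C P s \<and> dom s = P"

definition class_of :: "'a set set \<Rightarrow> 'a \<Rightarrow> 'a set" where
  "class_of P i = (THE A. A \<in> P \<and> i \<in> A)"

(* As n varies, R^n is the set of functions {1..n} \<rightarrow>\<^sub>E UNIV: coordinates x 1, ..., x n,
   with the value undefined elsewhere, so that R^0 is a single point. *)
definition polydiagonal :: "nat \<Rightarrow> nat set set \<Rightarrow> (nat set \<rightharpoonup> nat set) \<Rightarrow> (nat \<Rightarrow> real) set" where
  "polydiagonal n P s =
     {x \<in> {1..n} \<rightarrow>\<^sub>E UNIV. \<forall>i\<in>{1..n}. \<forall>j\<in>{1..n}.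
        (class_of P i = class_of P j \<longrightarrow> x i = x j) \<and>
        (s (class_of P i) = Some (class_of P j) \<longrightarrow> x i = - x j)}"

definition fully_tagged_polydiagonals :: "nat \<Rightarrow> (nat \<Rightarrow> real) set set" where
  "fully_tagged_polydiagonals n =
     {polydiagonal n P s | P s. fully_tagged_partition {1..n} P s}"

end

theory Submission imports Defs begin

text \<open>
  A fully tagged polydiagonal subspace determines its tagged partition: for a class \<open>A\<close> that is not
  fixed, the vector that is \<open>1\<close> on \<open>A\<close>, \<open>-1\<close> on the partner of \<open>A\<close> and \<open>0\<close> elsewhere lies in the
  subspace and separates \<open>A\<close> from all other classes. So it suffices to count partitions with a total
  involution having at most one fixed class \<open>Z\<close>. Removing \<open>Z\<close> (empty if there is none) leaves a
  fixed-point-free involution on the classes of the complement, so \<open>F = e\<^sup>x U\<close>, where \<open>U\<close> counts the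
  fixed-point-free ones. Removing the class of a new point together with its partner gives
  \<open>u\<^sub>n\<^sub>+\<^sub>1 = (\<Sum>k. (n choose k) (2\<^sup>k - 1) u\<^sub>n\<^sub>-\<^sub>k)\<close>: of the other \<open>k\<close> points involved, any nonempty subset can
  be the partner. This is the equation \<open>U' = (e\<^sup>2\<^sup>x - e\<^sup>x) U\<close>, which \<open>e\<^sup>-\<^sup>x F\<close> satisfies for the claimed \<open>F\<close>.
\<close>

unbundle fps_syntax

section \<open>Fully tagged partitions encoded by their involutions\<close>

text \<open>Since the involutions are total, the partition is encoded as the domain of the involution.\<close>

definition pairings :: "'a set \<Rightarrow> ('a set \<rightharpoonup> 'a set) set" where
  "pairings C = {s. partition_on C (dom s) \<and> (\<forall>A B. s A = Some B \<longleftrightarrow> s B = Some A) \<and> (\<forall>A. s A \<noteq> Some A)}"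

definition taggings :: "'a set \<Rightarrow> ('a set \<rightharpoonup> 'a set) set" where
  "taggings C = {s. fully_tagged_partition C (dom s) s}"

lemma taggings_iff:
  "s \<in> taggings C \<longleftrightarrow> partition_on C (dom s) \<and> (\<forall>A B. s A = Some B \<longleftrightarrow> s B = Some A) \<and>
     (\<forall>A B. s A = Some A \<longrightarrow> s B = Some B \<longrightarrow> A = B)"
  unfolding taggings_def fully_tagged_partition_def tagged_partition_def partial_involution_def by blast

lemma taggingsI:
  assumes "partition_on C (dom s)" "\<And>A B. s A = Some B \<Longrightarrow> s B = Some A"
    "\<And>A B. s A = Some A \<Longrightarrow> s B = Some B \<Longrightarrow> A = B"
  shows "s \<in> taggings C"
  using assms unfolding taggings_iff by blast

lemma pairingsI:
  assumes "partition_on C (dom s)" "\<And>A B. s A = Some B \<Longrightarrow> s B = Some A \<and> B \<noteq> A"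
  shows "s \<in> pairings C"
  using assms unfolding pairings_def by blast

lemma partition_on_iff:
  "partition_on C P \<longleftrightarrow> (\<forall>A\<in>P. A \<noteq> {} \<and> A \<subseteq> C) \<and> (\<forall>x\<in>C. \<exists>A\<in>P. x \<in> A) \<and>
     (\<forall>A\<in>P. \<forall>B\<in>P. \<forall>x. x \<in> A \<longrightarrow> x \<in> B \<longrightarrow> A = B)"
  unfolding partition_on_def disjoint_def by fastforce

lemma partition_on_block:
  assumes "partition_on C P" "A \<in> P"
  shows "A \<noteq> {}" "A \<subseteq> C" "\<And>B x. B \<in> P \<Longrightarrow> x \<in> A \<Longrightarrow> x \<in> B \<Longrightarrow> A = B"
  using assms unfolding partition_on_iff by blast+

section \<open>Removing the fixed class, and removing a class together with its partner\<close>

lemma partition_on_Diff_Union: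
  assumes "partition_on C P" "Q \<subseteq> P"
  shows "partition_on (C - \<Union>Q) (P - Q)"
  unfolding partition_on_iff
proof (intro conjI ballI allI impI)
  fix A assume A: "A \<in> P - Q"
  show "A \<subseteq> C - \<Union>Q"
  proof
    fix x assume x: "x \<in> A"
    have "x \<notin> B" if "B \<in> Q" for B
      using partition_on_block(3)[OF assms(1), of A B x] A that assms(2) x by blast
    then show "x \<in> C - \<Union>Q" using partition_on_block(2)[OF assms(1)] A x by blast
  qed
qed (use assms in \<open>unfold partition_on_iff, blast+\<close>)

text \<open>Ensures that extending an involution on the classes of \<open>C - Z\<close> to
  \<open>Z\<close> overwrites no value: a class inside \<open>C - Z\<close> that equals
  \<open>Z\<close> would be empty.\<close>

lemma removed_set_notin_partition_on:
  assumes "partition_on (C - Z) P" "Z \<noteq> {}" shows "Z \<notin> P"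
  using partition_on_block[OF assms(1)] assms(2) by blast

lemma bij_betw_taggings:
  "bij_betw (\<lambda>(Z, s). if Z = {} then s else s(Z \<mapsto> Z))
     (SIGMA Z : Pow C. pairings (C - Z)) (taggings C)"
\<comment> \<open>At most one class is fixed, so the union of the fixed classes is that class if it
  exists and \<open>{}\<close> otherwise. As \<open>{}\<close> is never a class,
  \<open>Z = {}\<close> can stand for its absence.\<close>
proof (rule bij_betw_byWitness[where f' = "\<lambda>s. (\<Union>{A. s A = Some A}, s |` {A. s A \<noteq> Some A})"];
    intro ballI subsetI)
  fix p assume "p \<in> (SIGMA Z : Pow C. pairings (C - Z))"
  then obtain Z s where p: "p = (Z, s)" and Z: "Z \<subseteq> C" and s: "s \<in> pairings (C - Z)" by auto
  have part: "partition_on (C - Z) (dom s)" and inv: "\<And>A B. s A = Some B \<longleftrightarrow> s B = Some A" "\<And>A. s A \<noteq> Some A"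
    using s unfolding pairings_def by blast+
  show "(case case p of (Z, s) \<Rightarrow> if Z = {} then s else s(Z \<mapsto> Z) of
      s \<Rightarrow> (\<Union>{A. s A = Some A}, s |` {A. s A \<noteq> Some A})) = p"
  proof (cases "Z = {}")
    case True
    then show ?thesis using inv by (auto simp: p restrict_map_def)
  next
    case False
    then have "s Z = None" using removed_set_notin_partition_on[OF part] by auto
    moreover have "{A. (s(Z \<mapsto> Z)) A = Some A} = {Z}" using inv by auto
    ultimately show ?thesis using False inv by (auto simp: p restrict_map_def fun_eq_iff)
  qed
next
  fix s assume "s \<in> taggings C"
  then have part: "partition_on C (dom s)" and inv: "\<And>A B. s A = Some B \<longleftrightarrow> s B = Some A"
    and fix1: "\<And>A B. s A = Some A \<Longrightarrow> s B = Some B \<Longrightarrow> A = B"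
    unfolding taggings_iff by blast+
  show "(case (\<Union>{A. s A = Some A}, s |` {A. s A \<noteq> Some A}) of
      (Z, s) \<Rightarrow> if Z = {} then s else s(Z \<mapsto> Z)) = s"
  proof (cases "\<exists>A. s A = Some A")
    case False
    then show ?thesis by (auto simp: restrict_map_def)
  next
    case True
    then obtain A where A: "s A = Some A" by blast
    then have "{A. s A = Some A} = {A}" using fix1 by auto
    moreover have "A \<noteq> {}" using A part by (auto simp: partition_on_iff)
    ultimately show ?thesis using A fix1 by (auto simp: restrict_map_def fun_eq_iff)
  qed
next
  fix t assume "t \<in> (\<lambda>(Z, s). if Z = {} then s else s(Z \<mapsto> Z)) ` (SIGMA Z : Pow C. pairings (C - Z))"
  then obtain Z s where t: "t = (if Z = {} then s else s(Z \<mapsto> Z))"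
    and Z: "Z \<subseteq> C" and s: "s \<in> pairings (C - Z)" by auto
  have part: "partition_on (C - Z) (dom s)" and inv: "\<And>A B. s A = Some B \<longleftrightarrow> s B = Some A" "\<And>A. s A \<noteq> Some A"
    using s unfolding pairings_def by blast+
  show "t \<in> taggings C"
  proof (cases "Z = {}")
    case True
    then show ?thesis using part inv unfolding t taggings_iff by simp
  next
    case False
    then have sZ: "s Z = None" using removed_set_notin_partition_on[OF part] by auto
    have "disjnt Z (\<Union>(dom s))" using partition_onD1[OF part] by (auto simp: disjnt_def)
    then have "partition_on C (dom (s(Z \<mapsto> Z)))"
      using part Z False by (simp add: partition_on_insert)
    moreover have "(s(Z \<mapsto> Z)) B = Some A" if "(s(Z \<mapsto> Z)) A = Some B" for A B
      using that inv(1)[of A B] sZ by (auto split: if_splits)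
    moreover have "A = B" if "(s(Z \<mapsto> Z)) A = Some A" "(s(Z \<mapsto> Z)) B = Some B" for A B
      using that inv(2) by (auto split: if_splits)
    ultimately have "s(Z \<mapsto> Z) \<in> taggings C" by (rule taggingsI)
    then show ?thesis using False by (simp add: t)
  qed
next
  fix p assume "p \<in> (\<lambda>s. (\<Union>{A. s A = Some A}, s |` {A. s A \<noteq> Some A})) ` taggings C"
  then obtain s where p: "p = (\<Union>{A. s A = Some A}, s |` {A. s A \<noteq> Some A})"
    and "s \<in> taggings C" by blast
  then have part: "partition_on C (dom s)" and inv: "\<And>A B. s A = Some B \<longleftrightarrow> s B = Some A"
    unfolding taggings_iff by blast+
  have "s |` {A. s A \<noteq> Some A} \<in> pairings (C - \<Union>{A. s A = Some A})"
  proof (rule pairingsI)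
    have "partition_on (C - \<Union>{A. s A = Some A}) (dom s - {A. s A = Some A})"
      by (rule partition_on_Diff_Union[OF part]) auto
    moreover have "dom s - {A. s A = Some A} = dom (s |` {A. s A \<noteq> Some A})"
      by auto
    ultimately show "partition_on (C - \<Union>{A. s A = Some A}) (dom (s |` {A. s A \<noteq> Some A}))"
      by simp
  next
    fix D E assume "(s |` {A. s A \<noteq> Some A}) D = Some E"
    then show "(s |` {A. s A \<noteq> Some A}) E = Some D \<and> E \<noteq> D"
      using inv[of D E] by (auto simp: restrict_map_def split: if_splits)
  qed
  moreover have "\<Union>{A. s A = Some A} \<subseteq> C"
    by (rule Sup_least) (use partition_on_block(2)[OF part] in blast)
  ultimately show "p \<in> (SIGMA Z : Pow C. pairings (C - Z))"
    unfolding p by blast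
qed

text \<open>\<open>K\<close> collects the points other than \<open>a\<close> in the class of
  \<open>a\<close> and in its partner \<open>B\<close>, so the class of \<open>a\<close> is
  \<open>insert a (K - B)\<close>. This class may be just the singleton of \<open>a\<close>, so
  \<open>B = K\<close> is allowed, while \<open>B = {}\<close> is not.\<close>

lemma bij_betw_pairings:
  assumes a: "a \<notin> C"
  shows "bij_betw (\<lambda>(K, B, s). s(insert a (K - B) \<mapsto> B, B \<mapsto> insert a (K - B)))
     (SIGMA K : Pow C. (Pow K - {{}}) \<times> pairings (C - K)) (pairings (insert a C))"
  unfolding bij_betw_def
proof (intro conjI subset_antisym subsetI)
  show "inj_on (\<lambda>(K, B, s). s(insert a (K - B) \<mapsto> B, B \<mapsto> insert a (K - B)))
     (SIGMA K : Pow C. (Pow K - {{}}) \<times> pairings (C - K))"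
  proof (rule inj_onI)
    fix p q
    assume "p \<in> (SIGMA K : Pow C. (Pow K - {{}}) \<times> pairings (C - K))"
      and "q \<in> (SIGMA K : Pow C. (Pow K - {{}}) \<times> pairings (C - K))"
      and f_eq: "(\<lambda>(K, B, s). s(insert a (K - B) \<mapsto> B, B \<mapsto> insert a (K - B))) p =
        (\<lambda>(K, B, s). s(insert a (K - B) \<mapsto> B, B \<mapsto> insert a (K - B))) q"
    then obtain K B s K' B' s' where p: "p = (K, B, s)" and q: "q = (K', B', s')"
      and *: "K \<subseteq> C" "B \<subseteq> K" "B \<noteq> {}" "s \<in> pairings (C - K)"
        "K' \<subseteq> C" "B' \<subseteq> K'" "B' \<noteq> {}" "s' \<in> pairings (C - K')"
      by blast
    define A where "A = insert a (K - B)"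
    define A' where "A' = insert a (K' - B')"
    have eq: "s(A \<mapsto> B, B \<mapsto> A) = s'(A' \<mapsto> B', B' \<mapsto> A')"
      using f_eq unfolding p q prod.case A_def A'_def .
    have part: "partition_on (C - K) (dom s)" "partition_on (C - K') (dom s')"
      using * unfolding pairings_def by blast+
    \<comment> \<open>\<open>A\<close> and \<open>A'\<close> are the only classes through
      \<open>a\<close>, which forces \<open>A = A'\<close>. Then \<open>B\<close> is the value at
      \<open>A\<close>, and \<open>K\<close> consists of the points of \<open>A\<close> and
      \<open>B\<close> other than \<open>a\<close>.\<close>
    have nota: "a \<notin> D" if "D \<in> dom s \<or> D \<in> dom s' \<or> D = B \<or> D = B'" for D
      using that * a partition_on_block(2)[OF part(1), of D] partition_on_block(2)[OF part(2), of D] by blast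
    have "A \<in> dom (s(A \<mapsto> B, B \<mapsto> A))" by simp
    then have "A \<in> dom (s'(A' \<mapsto> B', B' \<mapsto> A'))" unfolding eq .
    then have AA': "A = A'" using nota[of A] by (auto simp: A_def)
    have AB: "A \<noteq> B" "A' \<noteq> B'" using nota by (auto simp: A_def A'_def)
    have BB': "B = B'" using fun_cong[OF eq, of A] AB AA' by simp
    have "K = A \<union> B - {a}" "K' = A' \<union> B' - {a}"
      using * a by (auto simp: A_def A'_def)
    then have KK': "K = K'" using AA' BB' by simp
    \<comment> \<open>The updates hide the values of \<open>s\<close> and \<open>s'\<close> at
      \<open>A\<close> and \<open>B\<close>, but both maps are undefined there.\<close>
    have "s A = None" "s' A = None" using nota[of A] by (auto simp: A_def)
    moreover have "s B = None" "s' B = None"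
      using * part BB' partition_onD1[OF part(1)] partition_onD1[OF part(2)] by blast+
    ultimately have "s D = s' D" for D
      using fun_cong[OF eq, of D] AA' BB' by (auto split: if_splits)
    then show "p = q" unfolding p q using KK' BB' by auto
  qed
next
  fix t assume "t \<in> (\<lambda>(K, B, s). s(insert a (K - B) \<mapsto> B, B \<mapsto> insert a (K - B))) `
     (SIGMA K : Pow C. (Pow K - {{}}) \<times> pairings (C - K))"
  then obtain p where p: "p \<in> (SIGMA K : Pow C. (Pow K - {{}}) \<times> pairings (C - K))"
    and tp: "t = (\<lambda>(K, B, s). s(insert a (K - B) \<mapsto> B, B \<mapsto> insert a (K - B))) p" by (elim imageE)
  obtain K B s where p_eq: "p = (K, B, s)" by (cases p)
  have t: "t = s(insert a (K - B) \<mapsto> B, B \<mapsto> insert a (K - B))"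
    using tp unfolding p_eq prod.case .
  have *: "K \<subseteq> C" "B \<subseteq> K" "B \<noteq> {}" "s \<in> pairings (C - K)"
    using p unfolding p_eq by blast+
  define A where "A = insert a (K - B)"
  have part: "partition_on (C - K) (dom s)" and inv: "\<And>A B. s A = Some B \<longleftrightarrow> s B = Some A" "\<And>A. s A \<noteq> Some A"
    using * unfolding pairings_def by blast+
  have sB: "s B = None" using partition_onD1[OF part] * by blast
  have sA: "s A = None" using partition_onD1[OF part] a by (auto simp: A_def)
  \<comment> \<open>The domain of \<open>t\<close> is assembled in two insertions: \<open>B\<close>
    restores part of \<open>K\<close>, then \<open>A\<close> supplies the rest together with
    \<open>a\<close>.\<close>
  have 1: "partition_on (C - K \<union> B) (insert B (dom s))"
  proof (subst partition_on_insert)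
    show "disjnt B (\<Union> (dom s))" unfolding partition_onD1[OF part, symmetric] using * by (auto simp: disjnt_def)
    have "C - K \<union> B - B = C - K" using * by auto
    then show "partition_on (C - K \<union> B - B) (dom s) \<and> B \<subseteq> C - K \<union> B \<and> B \<noteq> {}"
      using part * by auto
  qed
  have "partition_on (insert a C) (insert A (insert B (dom s)))"
  proof (subst partition_on_insert)
    show "disjnt A (\<Union> (insert B (dom s)))" unfolding partition_onD1[OF 1, symmetric]
      using * a by (auto simp: disjnt_def A_def)
    have "insert a C - A = C - K \<union> B" using * a by (auto simp: A_def)
    then show "partition_on (insert a C - A) (insert B (dom s)) \<and> A \<subseteq> insert a C \<and> A \<noteq> {}"
      using 1 * by (auto simp: A_def)
  qed
  then have "partition_on (insert a C) (dom t)" by (simp add: t A_def insert_commute)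
  moreover have "A \<noteq> B" using * a by (auto simp: A_def)
  then have "t E = Some D \<and> E \<noteq> D" if "t D = Some E" for D E
    using that inv(1)[of D E] inv(2)[of D] sA sB unfolding t A_def[symmetric]
    by (auto split: if_splits)
  ultimately show "t \<in> pairings (insert a C)"
    by (rule pairingsI)
next
  fix t assume "t \<in> pairings (insert a C)"
  then have part: "partition_on (insert a C) (dom t)" and inv: "\<And>A B. t A = Some B \<longleftrightarrow> t B = Some A" "\<And>A. t A \<noteq> Some A"
    unfolding pairings_def by blast+
  \<comment> \<open>The preimage is read off from the class \<open>A\<close> of \<open>a\<close> and
    its partner \<open>B\<close>, which is distinct and hence disjoint from
    \<open>A\<close>.\<close>
  have "a \<in> \<Union>(dom t)" unfolding partition_onD1[OF part, symmetric] by simp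
  then obtain A B where A: "a \<in> A" "t A = Some B" by blast
  then have B: "t B = Some A" "A \<noteq> B" using inv by auto
  have AB: "A \<inter> B = {}" using partition_on_block(3)[OF part] A B by blast
  have B': "B \<noteq> {}" "A \<subseteq> insert a C" "B \<subseteq> insert a C"
    using partition_on_block[OF part] A B by auto
  define K where "K = A \<union> B - {a}"
  define s where "s = t |` (- {A, B})"
  have A_eq: "A = insert a (K - B)" using A AB by (auto simp: K_def)
  have K: "K \<subseteq> C" "B \<subseteq> K" using A AB B' by (auto simp: K_def)
  have "partition_on (insert a C - \<Union>{A, B}) (dom t - {A, B})"
    by (rule partition_on_Diff_Union[OF part]) (use A B in auto)
  moreover have "insert a C - \<Union>{A, B} = C - K" using A a by (auto simp: K_def)
  moreover have "dom t - {A, B} = dom s" by (auto simp: s_def)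
  moreover have "s E = Some D \<and> E \<noteq> D" if "s D = Some E" for D E
    using that inv(1)[of D E] inv(2)[of D] A B by (auto simp: s_def restrict_map_def split: if_splits)
  ultimately have "s \<in> pairings (C - K)" by (metis pairingsI)
  moreover have "t = s(A \<mapsto> B, B \<mapsto> A)" using A B by (auto simp: s_def restrict_map_def fun_eq_iff)
  ultimately have "(K, B, s) \<in> (SIGMA K : Pow C. (Pow K - {{}}) \<times> pairings (C - K))"
    "t = (\<lambda>(K, B, s). s(insert a (K - B) \<mapsto> B, B \<mapsto> insert a (K - B))) (K, B, s)"
    using K B' A_eq by auto
  then show "t \<in> (\<lambda>(K, B, s). s(insert a (K - B) \<mapsto> B, B \<mapsto> insert a (K - B))) `
     (SIGMA K : Pow C. (Pow K - {{}}) \<times> pairings (C - K))" by (rule rev_image_eqI)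
qed

section \<open>Generating functions and the count of involutions\<close>

lemma sum_Pow_card:
  fixes g :: "nat \<Rightarrow> 'b::semiring_1"
  assumes "finite C"
  shows "(\<Sum>K\<in>Pow C. g (card K)) = (\<Sum>k\<le>card C. of_nat (card C choose k) * g k)"
proof -
  have "(\<Sum>K\<in>Pow C. g (card K)) = (\<Sum>k\<le>card C. \<Sum>K\<in>{K\<in>Pow C. card K = k}. g (card K))"
    by (rule sum.group[symmetric]) (use assms in \<open>auto intro: card_mono\<close>)
  also have "\<dots> = (\<Sum>k\<le>card C. of_nat (card C choose k) * g k)"
    using n_subsets[OF assms] by (intro sum.cong) auto
  finally show ?thesis .
qed

text \<open>The inner series has constant term \<open>(1 - 2 + 0 + 1) / 2 = 0\<close>, so
  \<open>oo\<close> is a genuine substitution into the exponential series.\<close>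

definition egf :: "real fps" where
  "egf = fps_exp 1 oo ((fps_exp 2 - 2 * fps_exp 1 + 2 * fps_X + 1) / 2)"

text \<open>The candidate for the series U of the fixed-point-free involutions, confirmed in
  \<open>card_pairings\<close>.\<close>

definition pairings_egf :: "real fps" where
  "pairings_egf = egf * fps_exp (- 1)"

text \<open>The exponent of \<open>egf\<close> has derivative
  \<open>fps_exp 2 - fps_exp 1 + 1\<close>, and the factor \<open>fps_exp (- 1)\<close> cancels the
  summand 1 in the logarithmic derivative.\<close>

lemma fps_deriv_pairings_egf: "fps_deriv pairings_egf = (fps_exp 2 - fps_exp 1) * pairings_egf"
proof -
  define h :: "real fps" where "h = (fps_exp 2 - 2 * fps_exp 1 + 2 * fps_X + 1) / 2"
  \<comment> \<open>Division by the unit 2 becomes multiplication by a constant series, so that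
    coefficients can be computed termwise.\<close>
  have "h = (fps_exp 2 - 2 * fps_exp 1 + 2 * fps_X + 1) * inverse 2"
    unfolding h_def by (rule fps_divide_unit) simp
  then have h: "h = (fps_exp 2 - fps_const 2 * fps_exp 1 + fps_const 2 * fps_X + 1) * fps_const (inverse 2)"
    by (simp only: inverse_fps_numeral) (simp only: numeral_fps_const)
  have h0: "h $ 0 = 0" by (simp add: h)
  have deriv_egf: "fps_deriv egf = egf * fps_deriv h"
    unfolding egf_def h_def[symmetric] fps_compose_deriv[OF h0] by simp
  have deriv_h: "fps_deriv h = fps_exp 2 - fps_exp 1 + 1"
    by (rule fps_ext) (simp add: h field_simps)
  have "fps_deriv pairings_egf = egf * fps_deriv h * fps_exp (- 1) - egf * fps_exp (- 1)"
    by (simp add: pairings_egf_def deriv_egf flip: fps_const_neg)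
  also have "\<dots> = (fps_exp 2 - fps_exp 1) * pairings_egf"
    unfolding deriv_h pairings_egf_def by (simp add: ring_distribs mult_ac)
  finally show ?thesis .
qed

lemma egf_eq: "egf = fps_exp 1 * pairings_egf"
proof -
  have "fps_exp 1 * fps_exp (- 1 :: real) = 1"
    by (simp flip: fps_exp_add_mult)
  then show ?thesis by (simp add: pairings_egf_def mult.left_commute)
qed

text \<open>The differential equation for \<open>pairings_egf\<close> is the recursion given by
  \<open>bij_betw_pairings\<close>. The induction runs over proper subsets because that recursion
  passes to \<open>C - K\<close> for every \<open>K\<close>; finiteness is carried along to count
  the disjoint union over \<open>K\<close>.\<close>

lemma card_pairings:
  assumes "finite C"
  shows "finite (pairings C) \<and> real (card (pairings C)) = fact (card C) * pairings_egf $ card C"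
  using assms
proof (induction C rule: finite_psubset_induct)
  case (psubset D)
  show ?case
  proof (cases "D = {}")
    case True
    \<comment> \<open>The initial value: one empty involution, matching the constant term 1 of both
      factors of \<open>pairings_egf\<close>.\<close>
    have "pairings D = {Map.empty}" by (auto simp: True pairings_def partition_on_empty)
    then show ?thesis using True by (simp add: pairings_egf_def egf_def)
  next
    case False
    then obtain a C where D: "D = insert a C" "a \<notin> C" by (meson mk_disjoint_insert ex_in_conv)
    then have C: "finite C" using psubset by simp
    define n where "n = card C"
    have IH: "finite (pairings (C - K))"
      "real (card (pairings (C - K))) = fact (n - card K) * pairings_egf $ (n - card K)"
      if "K \<in> Pow C" for K
    proof -
      have "C - K \<subset> D" using D by auto
      from psubset.IH[OF this] show "finite (pairings (C - K))"
        "real (card (pairings (C - K))) = fact (n - card K) * pairings_egf $ (n - card K)"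
        using that C by (auto simp: card_Diff_subset finite_subset n_def)
    qed
    let ?S = "SIGMA K : Pow C. (Pow K - {{}}) \<times> pairings (C - K)"
    have fin: "\<forall>K\<in>Pow C. finite ((Pow K - {{}}) \<times> pairings (C - K))"
      using IH(1) C by (auto intro: finite_subset)
    have finS: "finite ?S"
      by (rule finite_SigmaI) (use C fin in \<open>simp, blast\<close>)
    have bij: "bij_betw (\<lambda>(K, B, s). s(insert a (K - B) \<mapsto> B, B \<mapsto> insert a (K - B))) ?S (pairings D)"
      unfolding D(1) by (rule bij_betw_pairings[OF D(2)])
    \<comment> \<open>A set \<open>K\<close> has \<open>2 ^ card K - 1\<close> nonempty subsets
      \<open>B\<close>.\<close>
    have "real (card ?S) = (\<Sum>K\<in>Pow C. (2 ^ card K - 1) * (fact (n - card K) * pairings_egf $ (n - card K)))"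
      using C fin IH(2)
      by (auto simp: card_SigmaI card_cartesian_product card_Diff_subset card_Pow finite_subset of_nat_diff intro!: sum.cong)
    also have "\<dots> = (\<Sum>k\<le>n. of_nat (n choose k) * ((2 ^ k - 1) * (fact (n - k) * pairings_egf $ (n - k))))"
      unfolding n_def by (rule sum_Pow_card[OF C])
    also have "\<dots> = (\<Sum>k\<le>n. fact n * ((2 ^ k - 1) / fact k * pairings_egf $ (n - k)))"
      by (intro sum.cong) (auto simp: binomial_fact field_simps)
    \<comment> \<open>\<open>(2 ^ k - 1) / fact k\<close> is the coefficient of
      \<open>fps_exp 2 - fps_exp 1\<close> at \<open>k\<close>, so the sum is a Cauchy
      product.\<close>
    also have "\<dots> = fact n * fps_deriv pairings_egf $ n"
      by (simp add: fps_deriv_pairings_egf fps_mult_nth sum_distrib_left atLeast0AtMost diff_divide_distrib)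
    \<comment> \<open>Here \<open>card D = n + 1\<close>: differentiation multiplies the coefficient
      at \<open>n + 1\<close> by \<open>n + 1\<close>, which turns \<open>fact n\<close> into
      \<open>fact (n + 1)\<close>.\<close>
    also have "\<dots> = fact (card D) * pairings_egf $ card D"
      using D C by (simp add: n_def algebra_simps)
    finally show ?thesis
      using bij_betw_same_card[OF bij] bij_betw_finite[OF bij] finS by simp
  qed
qed

text \<open>Every subset of \<open>C\<close>, the empty one included, occurs as \<open>Z\<close>
  with weight 1; these weights have generating function \<open>fps_exp 1\<close>, the first factor
  in \<open>egf_eq\<close>.\<close>

lemma card_taggings:
  assumes C: "finite C"
  shows "real (card (taggings C)) = fact (card C) * egf $ card C"
proof -
  define n where "n = card C"
  have fin: "\<forall>Z\<in>Pow C. finite (pairings (C - Z))" using card_pairings C by blast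
  have "real (card (taggings C)) = real (card (SIGMA Z : Pow C. pairings (C - Z)))"
    using bij_betw_same_card[OF bij_betw_taggings[of C]] by simp
  also have "\<dots> = (\<Sum>Z\<in>Pow C. fact (n - card Z) * pairings_egf $ (n - card Z))"
    using C fin by (auto simp: card_SigmaI card_pairings card_Diff_subset finite_subset n_def intro!: sum.cong)
  also have "\<dots> = (\<Sum>k\<le>n. of_nat (n choose k) * (fact (n - k) * pairings_egf $ (n - k)))"
    unfolding n_def by (rule sum_Pow_card[OF C])
  also have "\<dots> = (\<Sum>k\<le>n. fact n * (1 / fact k * pairings_egf $ (n - k)))"
    by (intro sum.cong) (auto simp: binomial_fact field_simps)
  also have "\<dots> = fact n * egf $ n"
    by (simp add: egf_eq fps_mult_nth sum_distrib_left atLeast0AtMost)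
  finally show ?thesis by (simp add: n_def)
qed

section \<open>Recovering the tagged partition from its subspace\<close>

lemma class_of_eq:
  assumes "partition_on C P" "A \<in> P" "i \<in> A"
  shows "class_of P i = A"
  unfolding class_of_def using partition_on_block(3)[OF assms(1)] assms by (intro the_equality) blast+

lemma polydiagonal_iff:
  assumes "partition_on {1..n} P"
  shows "x \<in> polydiagonal n P s \<longleftrightarrow> x \<in> {1..n} \<rightarrow>\<^sub>E UNIV \<and>
    (\<forall>A\<in>P. \<forall>i\<in>A. \<forall>B\<in>P. \<forall>j\<in>B.
      (A = B \<longrightarrow> x i = x j) \<and> (s A = Some B \<longrightarrow> x i = - x j))"
proof -
  \<comment> \<open>Each point lies in exactly one class, so ranging over points is ranging over
    classes and their members. Applied to \<open>i\<close> and then to \<open>j\<close>, this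
    eliminates \<open>class_of\<close>.\<close>
  have *: "(\<forall>i\<in>{1..n}. Q i (class_of P i)) \<longleftrightarrow> (\<forall>A\<in>P. \<forall>i\<in>A. Q i A)" for Q
  proof -
    have "(\<forall>i\<in>{1..n}. Q i (class_of P i)) \<longleftrightarrow> (\<forall>A\<in>P. \<forall>i\<in>A. Q i (class_of P i))"
      unfolding partition_onD1[OF assms] by blast
    also have "\<dots> \<longleftrightarrow> (\<forall>A\<in>P. \<forall>i\<in>A. Q i A)"
      by (intro ball_cong refl) (simp add: class_of_eq[OF assms])
    finally show ?thesis .
  qed
  have "(\<forall>i\<in>{1..n}. \<forall>j\<in>{1..n}.
      (class_of P i = class_of P j \<longrightarrow> x i = x j) \<and> (s (class_of P i) = Some (class_of P j) \<longrightarrow> x i = - x j)) \<longleftrightarrow>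
    (\<forall>A\<in>P. \<forall>i\<in>A. \<forall>j\<in>{1..n}.
      (A = class_of P j \<longrightarrow> x i = x j) \<and> (s A = Some (class_of P j) \<longrightarrow> x i = - x j))"
    by (rule *)
  also have "\<dots> \<longleftrightarrow> (\<forall>A\<in>P. \<forall>i\<in>A. \<forall>B\<in>P. \<forall>j\<in>B.
      (A = B \<longrightarrow> x i = x j) \<and> (s A = Some B \<longrightarrow> x i = - x j))"
    by (intro ball_cong refl *)
  finally show ?thesis unfolding polydiagonal_def by blast
qed

text \<open>Restricted to \<open>C\<close> because points of the coordinate space are extensional
  functions, \<open>undefined\<close> off the coordinates.\<close>

definition sign_vector :: "'a set \<Rightarrow> ('a set \<rightharpoonup> 'a set) \<Rightarrow> 'a set \<Rightarrow> 'a \<Rightarrow> real" where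
  "sign_vector C s A = restrict (\<lambda>i. if i \<in> A then 1 else if i \<in> the (s A) then - 1 else 0) C"

lemma sign_vector_eq:
  assumes s: "s \<in> taggings C" and D: "D \<in> dom s" and E: "E \<in> dom s" "i \<in> E"
  shows "sign_vector C s D i = (if E = D then 1 else if s D = Some E then - 1 else 0)"
proof -
  have part: "partition_on C (dom s)" and inv: "\<And>A B. s A = Some B \<longleftrightarrow> s B = Some A"
    using s unfolding taggings_iff by blast+
  obtain D' where D': "s D = Some D'" using D by blast
  then have "s D' = Some D" unfolding inv[of D] .
  then have "i \<in> D' \<longleftrightarrow> D' = E"
    using partition_on_block(3)[OF part _ E(1)] E(2) by blast
  moreover have "i \<in> D \<longleftrightarrow> E = D"
    using partition_on_block(3)[OF part D E(1)] E(2) by blast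
  moreover have "i \<in> C" using partition_on_block(2)[OF part E(1)] E(2) by blast
  ultimately show ?thesis by (simp add: sign_vector_def D')
qed

text \<open>The involution exchanges the class with value 1 and the class with value -1 and permutes
  the classes with value 0. A fixed \<open>A\<close> must be excluded, since the subspace forces the
  value 0 on it.\<close>

lemma sign_vector_in_polydiagonal:
  assumes s: "s \<in> taggings {1..n}" and A: "A \<in> dom s" "s A \<noteq> Some A"
  shows "sign_vector {1..n} s A \<in> polydiagonal n (dom s) s"
proof -
  have part: "partition_on {1..n} (dom s)" and inv: "\<And>A B. s A = Some B \<longleftrightarrow> s B = Some A"
    using s unfolding taggings_iff by blast+
  note val = sign_vector_eq[OF s A(1)]
  show ?thesis
    unfolding polydiagonal_iff[OF part]
  proof (intro conjI ballI impI)
    show "sign_vector {1..n} s A \<in> {1..n} \<rightarrow>\<^sub>E UNIV" by (simp add: sign_vector_def)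
  next
    fix D i E j assume *: "D \<in> dom s" "i \<in> D" "E \<in> dom s" "j \<in> E"
    show "sign_vector {1..n} s A i = sign_vector {1..n} s A j" if "D = E"
      unfolding val[OF *(1,2)] val[OF *(3,4)] that ..
    show "sign_vector {1..n} s A i = - sign_vector {1..n} s A j" if DE: "s D = Some E"
    proof -
      have ED: "s E = Some D" using DE unfolding inv[of D] .
      \<comment> \<open>Both values thus depend only on whether \<open>D = A\<close> or
        \<open>E = A\<close>, with opposite signs; the two cannot hold together as \<open>A\<close>
        is not fixed.\<close>
      have "D = A \<longleftrightarrow> s A = Some E" using DE ED inv[of A E] by auto
      moreover have "E = A \<longleftrightarrow> s A = Some D" using DE ED inv[of A D] by auto
      ultimately show ?thesis
        unfolding val[OF *(1,2)] val[OF *(3,4)] using A(2) by auto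
    qed
  qed
qed

text \<open>Since at most one class is fixed, of two distinct classes \<open>A\<close> and
  \<open>B\<close> at least one has a sign vector in the subspace, and that vector refutes any
  relation not imposed by \<open>s\<close>.\<close>

lemma polydiagonal_block_iff:
  assumes s: "s \<in> taggings {1..n}" and A: "A \<in> dom s" "i \<in> A" and B: "B \<in> dom s" "j \<in> B"
  shows "(\<forall>x\<in>polydiagonal n (dom s) s. x i = x j) \<longleftrightarrow> A = B"
    and "(\<forall>x\<in>polydiagonal n (dom s) s. x i = - x j) \<longleftrightarrow> s A = Some B"
proof -
  have part: "partition_on {1..n} (dom s)" and inv: "\<And>A B. s A = Some B \<longleftrightarrow> s B = Some A"
    and fix1: "\<And>A B. s A = Some A \<Longrightarrow> s B = Some B \<Longrightarrow> A = B"
    using s unfolding taggings_iff by blast+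
  note mem = sign_vector_in_polydiagonal[OF s] and val = sign_vector_eq[OF s]
  have "\<not> (\<forall>x\<in>polydiagonal n (dom s) s. x i = x j)" if AB: "A \<noteq> B"
  proof (cases "s A = Some A")
    case False
    have "sign_vector {1..n} s A i \<noteq> sign_vector {1..n} s A j"
      unfolding val[OF A(1) A] val[OF A(1) B] using AB by simp
    then show ?thesis using mem[OF A(1) False] by blast
  next
    case True
    then have B_fix: "s B \<noteq> Some B" using fix1 AB by blast
    have "sign_vector {1..n} s B i \<noteq> sign_vector {1..n} s B j"
      unfolding val[OF B(1) A] val[OF B(1) B] using AB by simp
    then show ?thesis using mem[OF B(1) B_fix] by blast
  qed
  moreover have "x i = x j" if "x \<in> polydiagonal n (dom s) s" "A = B" for x
    using that A B unfolding polydiagonal_iff[OF part] by blast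
  ultimately show "(\<forall>x\<in>polydiagonal n (dom s) s. x i = x j) \<longleftrightarrow> A = B" by blast
  have "\<not> (\<forall>x\<in>polydiagonal n (dom s) s. x i = - x j)" if AB: "s A \<noteq> Some B"
  proof (cases "s A = Some A")
    case False
    have "sign_vector {1..n} s A i \<noteq> - sign_vector {1..n} s A j"
      unfolding val[OF A(1) A] val[OF A(1) B] using AB by simp
    then show ?thesis using mem[OF A(1) False] by blast
  next
    case True
    then have "A \<noteq> B" using AB by blast
    then have B_fix: "s B \<noteq> Some B" using fix1 True by blast
    have "s B \<noteq> Some A" using AB unfolding inv[of A] .
    then have "sign_vector {1..n} s B i \<noteq> - sign_vector {1..n} s B j"
      unfolding val[OF B(1) A] val[OF B(1) B] using \<open>A \<noteq> B\<close> by simp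
    then show ?thesis using mem[OF B(1) B_fix] by blast
  qed
  moreover have "x i = - x j" if "x \<in> polydiagonal n (dom s) s" "s A = Some B" for x
    using that A B unfolding polydiagonal_iff[OF part] by blast
  ultimately show "(\<forall>x\<in>polydiagonal n (dom s) s. x i = - x j) \<longleftrightarrow> s A = Some B" by blast
qed

text \<open>Which coordinates agree, and which are opposite, throughout the subspace determines the
  classes and then the involution.\<close>

lemma inj_on_polydiagonal: "inj_on (\<lambda>s. polydiagonal n (dom s) s) (taggings {1..n})"
proof (rule inj_onI)
  fix s t assume s: "s \<in> taggings {1..n}" and t: "t \<in> taggings {1..n}"
    and eq: "polydiagonal n (dom s) s = polydiagonal n (dom t) t"
  \<comment> \<open>Inclusion of graphs, stated for arbitrary \<open>s\<close> and \<open>t\<close>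
    so that it can be used in both directions.\<close>
  have *: "t A = Some B" if st: "s A = Some B" and s: "s \<in> taggings {1..n}" and t: "t \<in> taggings {1..n}"
    and eq: "polydiagonal n (dom s) s = polydiagonal n (dom t) t" for s t A B
  proof -
    have part: "partition_on {1..n} (dom s)" "partition_on {1..n} (dom t)"
      using s t unfolding taggings_iff by blast+
    have U: "\<Union>(dom s) = \<Union>(dom t)"
      using partition_onD1[OF part(1)] partition_onD1[OF part(2)] by simp
    \<comment> \<open>The classes of \<open>s\<close> and \<open>t\<close> through a common point
      \<open>i\<close> both consist of all \<open>j\<close> whose coordinate agrees with that of
      \<open>i\<close> on the common subspace.\<close>
    have sub: "D \<in> dom t" if D: "D \<in> dom s" for D
    proof -
      obtain i where i: "i \<in> D" using partition_on_block(1)[OF part(1) D] by blast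
      then obtain E where E: "E \<in> dom t" "i \<in> E" using U D by blast
      have "j \<in> D \<longleftrightarrow> j \<in> E" if j: "j \<in> \<Union>(dom s)" for j
      proof -
        obtain D' E' where j': "D' \<in> dom s" "j \<in> D'" "E' \<in> dom t" "j \<in> E'" using j U by blast
        have "D = D' \<longleftrightarrow> E = E'"
          using polydiagonal_block_iff(1)[OF s D i j'(1,2)]
            polydiagonal_block_iff(1)[OF t E j'(3,4)] eq by simp
        then show ?thesis
          using partition_on_block(3)[OF part(1) D j'(1)] partition_on_block(3)[OF part(2) E(1) j'(3)] j' by blast
      qed
      then have "D = E" using D E U by blast
      then show ?thesis using E by simp
    qed
    have AB: "A \<in> dom s" "B \<in> dom s" using st s unfolding taggings_iff by blast+
    then obtain i j where ij: "i \<in> A" "j \<in> B" using partition_on_block(1)[OF part(1)] by blast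
    show ?thesis
      using polydiagonal_block_iff(2)[OF s AB(1) ij(1) AB(2) ij(2)] polydiagonal_block_iff(2)[OF t sub[OF AB(1)] ij(1) sub[OF AB(2)] ij(2)] st eq
      by simp
  qed
  show "s = t"
  proof
    fix A show "s A = t A"
      using *[OF _ s t eq, of A] *[OF _ t s eq[symmetric], of A] by (cases "s A"; cases "t A") auto
  qed
qed

section \<open>From involutions to subspaces and their generating function\<close>

lemma card_fully_tagged_polydiagonals:
  "card (fully_tagged_polydiagonals n) = card (taggings {1..n})"
proof -
  \<comment> \<open>Being fully tagged means \<open>dom s = P\<close>, so the subspaces can be
    indexed by \<open>s\<close> alone.\<close>
  have "fully_tagged_polydiagonals n = (\<lambda>s. polydiagonal n (dom s) s) ` taggings {1..n}"
    by (auto simp: fully_tagged_polydiagonals_def taggings_def fully_tagged_partition_def)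
  then show ?thesis by (simp only: card_image[OF inj_on_polydiagonal])
qed

theorem proposition7p18:
  fixes f :: "nat \<Rightarrow> nat"
  assumes "\<And>n. f n = card (fully_tagged_polydiagonals n)"
  shows "Abs_fps (\<lambda>n. real (f n) / fact n) =
    fps_exp 1 oo ((fps_exp 2 - 2 * fps_exp 1 + 2 * fps_X + 1) / 2)"
  unfolding egf_def[symmetric]
  by (rule fps_ext) (simp add: assms card_fully_tagged_polydiagonals card_taggings)
end
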